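(* Consider a timelike photon propagating in the direction $e_3$ with spin vectors $s_1,s_2$, having associated spin $3$-vectors $\boldsymbol s_1,\boldsymbol s_2$ and complex amplitudes $E_1,E_2$. (1) Suppose $\boldsymbol s_1=\boldsymbol s_1^{\parallel}=\pm e_3$ or $\boldsymbol s_2=\boldsymbol s_2^{\parallel}=\pm e_3$. Then $E_2/E_1=\pm i$ (that is, $E_2/E_1\in\{i,-i\}$), and thus the photon has circular polarization. (2) Suppose $\boldsymbol s_1=\boldsymbol s_1^{\perp}$ and $\boldsymbol s_2=\boldsymbol s_2^{\perp}$, and $E_1\neq0$. Then $E_2/E_1=\pm|E_2|/|E_1|$ (that is, $E_2/E_1\in\{|E_2|/|E_1|,-|E_2|/|E_1|\}$), and thus the photon has linear polarization.
   Context: Let $e_1,e_2,e_3$ be an orthonormal basis of $\mathbb R^3$ (the spatial part of an orthonormal tetrad $e_0,\dots,e_3$), where $e_3$ is the photon's direction of propagation. The spin $3$-vectors $\boldsymbol s_1,\boldsymbol s_2\in\mathbb R^3$ are unit vectors with $\boldsymbol s_1\cdot\boldsymbol s_2=0$. Decompose $\boldsymbol s_j=\boldsymbol s_j^{\parallel}+\boldsymbol s_j^{\perp}$, where $\boldsymbol s_j^{\parallel}:=(\boldsymbol s_j\cdot e_3)e_3$. Since $\boldsymbol s_1\cdot\boldsymbol s_2=0$, at least one of $\boldsymbol s_1^\perp,\boldsymbol s_2^\perp$ is nonzero. If $\boldsymbol s_j^\perp\ne0$, set $\hat{\boldsymbol s}_j^\perp:=\boldsymbol s_j^\perp/|\boldsymbol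 s_j^\perp|$. If one of them is zero, say $\boldsymbol s_k^\perp=0$, and the other one has $\hat{\boldsymbol s}_j^\perp=\cos\theta\,e_1+\sin\theta\,e_2$, set $\hat{\boldsymbol s}_k^\perp:=\sin\theta\,e_1-\cos\theta\,e_2$. The complex amplitudes associated to the pair are, for $j=1,2$, $$E_j=\tfrac1{\sqrt2}\left[(|\boldsymbol s_1^\perp|+i|\boldsymbol s_1^\parallel|)\hat{\boldsymbol s}_1^\perp+(|\boldsymbol s_2^\perp|+i|\boldsymbol s_2^\parallel|)\hat{\boldsymbol s}_2^\perp\right]\cdot e_j .$$ A pair of amplitudes is called circularly polarized if $E_2/E_1=\pm i$, and linearly polarized (with $E_1\neq0$) if $E_2/E_1=\pm|E_2|/|E_1|$. *)

theory Defs
  imports "HOL-Analysis.Analysis"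
begin

text \<open>Three orthonormal vectors of \<open>real^3\<close> automatically form a basis; neither orientation is
  singled out.\<close>

definition orthonormal_frame :: "real^3 \<Rightarrow> real^3 \<Rightarrow> real^3 \<Rightarrow> bool" where
  "orthonormal_frame e1 e2 e3 \<longleftrightarrow>
     norm e1 = 1 \<and> norm e2 = 1 \<and> norm e3 = 1 \<and>
     e1 \<bullet> e2 = 0 \<and> e1 \<bullet> e3 = 0 \<and> e2 \<bullet> e3 = 0"

definition spin_pair :: "real^3 \<Rightarrow> real^3 \<Rightarrow> bool" where
  "spin_pair s1 s2 \<longleftrightarrow> norm s1 = 1 \<and> norm s2 = 1 \<and> s1 \<bullet> s2 = 0"

definition par :: "real^3 \<Rightarrow> real^3 \<Rightarrow> real^3" where
  "par e3 s = (s \<bullet> e3) *\<^sub>R e3"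

definition perp :: "real^3 \<Rightarrow> real^3 \<Rightarrow> real^3" where
  "perp e3 s = s - par e3 s"

text \<open>\<open>unit_perp e1 e2 e3 s t\<close> is the unit transverse direction attached to the spin vector \<open>s\<close>
  whose partner in the pair is \<open>t\<close>. The partner only matters when \<open>s\<close> has no transverse part;
  for a spin pair the transverse part of \<open>t\<close> is then nonzero, and although the angle \<open>\<theta>\<close> is
  determined only modulo \<open>2 * pi\<close>, the resulting vector does not depend on its choice.\<close>

definition unit_perp :: "real^3 \<Rightarrow> real^3 \<Rightarrow> real^3 \<Rightarrow> real^3 \<Rightarrow> real^3 \<Rightarrow> real^3" where
  "unit_perp e1 e2 e3 s t =
     (if perp e3 s \<noteq> 0 then perp e3 s /\<^sub>R norm (perp e3 s)
      else (let \<theta> = (SOME \<theta>. perp e3 t /\<^sub>R norm (perp e3 t) = cos \<theta> *\<^sub>R e1 + sin \<theta> *\<^sub>R e2)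
            in sin \<theta> *\<^sub>R e1 - cos \<theta> *\<^sub>R e2))"

text \<open>The amplitude along a real vector \<open>f\<close>; the amplitudes \<open>E\<^sub>1\<close> and \<open>E\<^sub>2\<close> are obtained for
  \<open>f = e1\<close> and \<open>f = e2\<close>. The dot product of a complex vector with \<open>f\<close> is the complex-bilinear
  extension of the real one, written out here by linearity.\<close>

definition amplitude ::
    "real^3 \<Rightarrow> real^3 \<Rightarrow> real^3 \<Rightarrow> real^3 \<Rightarrow> real^3 \<Rightarrow> real^3 \<Rightarrow> complex" where
  "amplitude e1 e2 e3 s1 s2 f =
     1 / complex_of_real (sqrt 2) *
     ((complex_of_real (norm (perp e3 s1)) + \<i> * complex_of_real (norm (par e3 s1)))
        * complex_of_real (unit_perp e1 e2 e3 s1 s2 \<bullet> f)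
    + (complex_of_real (norm (perp e3 s2)) + \<i> * complex_of_real (norm (par e3 s2)))
        * complex_of_real (unit_perp e1 e2 e3 s2 s1 \<bullet> f))"

text \<open>Since \<open>E2 / 0 = 0\<close>, circular polarization entails \<open>E1 \<noteq> 0\<close>.\<close>

definition circularly_polarized :: "complex \<Rightarrow> complex \<Rightarrow> bool" where
  "circularly_polarized E1 E2 \<longleftrightarrow> E2 / E1 = \<i> \<or> E2 / E1 = - \<i>"

definition linearly_polarized :: "complex \<Rightarrow> complex \<Rightarrow> bool" where
  "linearly_polarized E1 E2 \<longleftrightarrow> E1 \<noteq> 0 \<and>
     (E2 / E1 = complex_of_real (cmod E2 / cmod E1) \<or>
      E2 / E1 = - complex_of_real (cmod E2 / cmod E1))"

end

theory Submission
  imports Defs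
begin

text \<open>If one spin vector is \<open>e3\<close> or \<open>- e3\<close>, its partner
  \<open>t\<close> is a transverse unit vector, so
  \<open>t = cos \<theta> e1 + sin \<theta> e2\<close>. The partner then enters with coefficient 1,
  and the longitudinal vector with coefficient \<open>\<i>\<close> along
  \<open>sin \<theta> e1 - cos \<theta> e2\<close>. Hence the amplitudes are
  \<open>cis \<theta>\<close> and \<open>- \<i> * cis \<theta>\<close>, both over
  \<open>sqrt 2\<close>, and the phase cancels (\<open>amplitude_longitudinal_ratio\<close>). If
  both spin vectors are transverse, every coefficient is real, so both amplitudes are real
  (\<open>amplitude_transverse_real\<close>), and a quotient of reals is its modulus up to
  sign.\<close>

lemma orthonormal_frame_orthogonal_eq_0:
  assumes "orthonormal_frame e1 e2 e3" "v \<bullet> e1 = 0" "v \<bullet> e2 = 0" "v \<bullet> e3 = 0"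
  shows "v = 0"
proof -
  let ?B = "{e1, e2, e3}"
  have ortho: "e1 \<bullet> e2 = 0" "e1 \<bullet> e3 = 0" "e2 \<bullet> e3 = 0"
    and nonzero: "0 \<notin> ?B"
    using assms(1) by (auto simp: orthonormal_frame_def)
  have "pairwise orthogonal ?B"
    using ortho by (auto simp: pairwise_def orthogonal_def inner_commute)
  then have indep: "independent ?B"
    using nonzero by (rule pairwise_orthogonal_independent)
  have "e1 \<noteq> e2" "e1 \<noteq> e3" "e2 \<noteq> e3"
    using ortho nonzero by auto
  then have "card ?B = 3"
    by simp
  \<comment> \<open>Three independent vectors span a space of dimension 3; so \<open>v\<close>,
    orthogonal to each of them, is orthogonal to itself.\<close>
  then have "span ?B = UNIV"
    using card_ge_dim_independent[OF subset_UNIV indep] by auto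
  moreover have "orthogonal v x" if "x \<in> span ?B" for x
    using orthogonal_to_span[OF that, of v] assms(2-4) by (auto simp: orthogonal_def)
  ultimately show ?thesis
    by (metis UNIV_I orthogonal_self)
qed

text \<open>Subtracting the \<open>e1\<close> and \<open>e2\<close> components leaves a vector
  orthogonal to the whole frame, hence 0; the unit norm then puts the two coordinates on the unit
  circle. This guarantees that the angle chosen in \<open>unit_perp\<close> exists.\<close>

lemma transverse_unit_vector_polar:
  assumes frame: "orthonormal_frame e1 e2 e3" and "norm v = 1" "v \<bullet> e3 = 0"
  obtains \<theta> where "v = cos \<theta> *\<^sub>R e1 + sin \<theta> *\<^sub>R e2"
proof -
  have ip: "e1 \<bullet> e1 = 1" "e2 \<bullet> e2 = 1" "e1 \<bullet> e2 = 0" "e2 \<bullet> e1 = 0" "e1 \<bullet> e3 = 0" "e2 \<bullet> e3 = 0"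
    using frame by (auto simp: orthonormal_frame_def norm_eq_1 inner_commute)
  have "v - ((v \<bullet> e1) *\<^sub>R e1 + (v \<bullet> e2) *\<^sub>R e2) = 0"
    using assms ip by (intro orthonormal_frame_orthogonal_eq_0[OF frame])
      (simp_all add: inner_simps)
  then have v: "v = (v \<bullet> e1) *\<^sub>R e1 + (v \<bullet> e2) *\<^sub>R e2"
    by simp
  have "1 = v \<bullet> v"
    using assms(2) by (simp add: norm_eq_1)
  also have "\<dots> = ((v \<bullet> e1) *\<^sub>R e1 + (v \<bullet> e2) *\<^sub>R e2) \<bullet> v"
    using v by simp
  also have "\<dots> = (v \<bullet> e1)\<^sup>2 + (v \<bullet> e2)\<^sup>2"
    by (simp add: inner_simps power2_eq_square inner_commute)
  finally obtain \<theta> where "v \<bullet> e1 = cos \<theta>" "v \<bullet> e2 = sin \<theta>"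
    by (metis sincos_total_2pi)
  then show ?thesis
    using v that by metis
qed

lemma amplitude_commute:
  "amplitude e1 e2 e3 s t f = amplitude e1 e2 e3 t s f"
  by (simp add: amplitude_def add.commute)

text \<open>Only the norm of the longitudinal part enters the amplitude, so the sign of
  \<open>s\<close> is lost and the ratio is the same for \<open>e3\<close> and
  \<open>- e3\<close>.\<close>

lemma amplitude_longitudinal_ratio:
  assumes frame: "orthonormal_frame e1 e2 e3" and pair: "spin_pair s t"
    and s: "s = e3 \<or> s = - e3"
  shows "amplitude e1 e2 e3 s t e2 / amplitude e1 e2 e3 s t e1 = - \<i>"
proof -
  have ip: "e1 \<bullet> e1 = 1" "e2 \<bullet> e2 = 1" "e3 \<bullet> e3 = 1" "e1 \<bullet> e2 = 0" "e2 \<bullet> e1 = 0"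
    and "norm e3 = 1"
    using frame by (auto simp: orthonormal_frame_def norm_eq_1 inner_commute)
  have t: "norm t = 1" "t \<bullet> e3 = 0"
    using pair s by (auto simp: spin_pair_def inner_commute)
  have par_s: "norm (par e3 s) = 1" and perp_s: "perp e3 s = 0"
    using s ip \<open>norm e3 = 1\<close> by (auto simp: par_def perp_def)
  have par_t: "par e3 t = 0" and perp_t: "perp e3 t = t"
    using t by (auto simp: par_def perp_def)
  \<comment> \<open>This is the very choice made inside \<open>unit_perp\<close>, since normalizing
    the transverse part of \<open>t\<close> gives back \<open>t\<close>.\<close>
  define \<theta> where "\<theta> = (SOME \<theta>. t = cos \<theta> *\<^sub>R e1 + sin \<theta> *\<^sub>R e2)"
  have t_eq: "t = cos \<theta> *\<^sub>R e1 + sin \<theta> *\<^sub>R e2"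
    unfolding \<theta>_def using transverse_unit_vector_polar[OF frame t] by (metis (mono_tags) someI_ex)
  have u_t: "unit_perp e1 e2 e3 t s = t"
    using t by (auto simp: unit_perp_def perp_t)
  have u_s: "unit_perp e1 e2 e3 s t = sin \<theta> *\<^sub>R e1 - cos \<theta> *\<^sub>R e2"
    using t by (simp add: unit_perp_def perp_s perp_t \<theta>_def Let_def)
  have te: "t \<bullet> e1 = cos \<theta>" "t \<bullet> e2 = sin \<theta>"
    by (subst t_eq, simp add: inner_simps ip)+
  have 1: "amplitude e1 e2 e3 s t e1 = cis \<theta> / complex_of_real (sqrt 2)"
    by (simp add: amplitude_def par_s perp_s par_t perp_t t u_t u_s te inner_simps ip
        complex_eq_iff)
  have 2: "amplitude e1 e2 e3 s t e2 = - \<i> * cis \<theta> / complex_of_real (sqrt 2)"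
    by (simp add: amplitude_def par_s perp_s par_t perp_t t u_t u_s te inner_simps ip
        complex_eq_iff)
  show ?thesis
    by (simp add: 1 2 cis_neq_zero)
qed

text \<open>The longitudinal norms are the only source of imaginary parts, and here they
  vanish.\<close>

lemma amplitude_transverse_real:
  assumes "s = perp e3 s" "t = perp e3 t"
  shows "amplitude e1 e2 e3 s t f \<in> \<real>"
proof -
  have "par e3 s = 0" "par e3 t = 0"
    using assms by (auto simp: perp_def)
  then show ?thesis
    by (simp add: amplitude_def)
qed

text \<open>The sign is that of the real quotient; for \<open>w = 0\<close> all sides are 0 because
  division by zero yields 0.\<close>

lemma Reals_divide_eq_pm_norm:
  assumes "z \<in> \<real>" "w \<in> \<real>"
  shows "z / w = complex_of_real (cmod z / cmod w) \<or> z / w = - complex_of_real (cmod z / cmod w)"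
proof -
  obtain x y where "z = complex_of_real x" "w = complex_of_real y"
    using assms by (auto elim!: Reals_cases)
  then show ?thesis
    by (auto simp: abs_if)
qed

theorem lemma6p1:
  fixes e1 e2 e3 s1 s2 :: "real^3" and E1 E2 :: complex
  assumes "orthonormal_frame e1 e2 e3"
    and "spin_pair s1 s2"
    and "E1 = amplitude e1 e2 e3 s1 s2 e1"
    and "E2 = amplitude e1 e2 e3 s1 s2 e2"
  shows "((s1 = par e3 s1 \<and> (s1 = e3 \<or> s1 = - e3)) \<or>
          (s2 = par e3 s2 \<and> (s2 = e3 \<or> s2 = - e3))
            \<longrightarrow> (E2 / E1 = \<i> \<or> E2 / E1 = - \<i>) \<and> circularly_polarized E1 E2) \<and>
         (s1 = perp e3 s1 \<and> s2 = perp e3 s2 \<and> E1 \<noteq> 0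
            \<longrightarrow> (E2 / E1 = complex_of_real (cmod E2 / cmod E1) \<or>
                 E2 / E1 = - complex_of_real (cmod E2 / cmod E1)) \<and>
                linearly_polarized E1 E2)"
proof (intro conjI impI)
  assume "(s1 = par e3 s1 \<and> (s1 = e3 \<or> s1 = - e3)) \<or> (s2 = par e3 s2 \<and> (s2 = e3 \<or> s2 = - e3))"
  then have "s1 = e3 \<or> s1 = - e3 \<or> s2 = e3 \<or> s2 = - e3"
    by blast
  moreover have "spin_pair s2 s1"
    using assms(2) by (simp add: spin_pair_def inner_commute)
  \<comment> \<open>The amplitude is symmetric in the pair, so a longitudinal \<open>s2\<close>
    reduces to the case of a longitudinal first vector.\<close>
  ultimately have "E2 / E1 = - \<i>"
    using assms amplitude_longitudinal_ratio amplitude_commute by metis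
  then show "E2 / E1 = \<i> \<or> E2 / E1 = - \<i>" "circularly_polarized E1 E2"
    by (simp_all add: circularly_polarized_def)
next
  assume *: "s1 = perp e3 s1 \<and> s2 = perp e3 s2 \<and> E1 \<noteq> 0"
  then have "E1 \<in> \<real>" "E2 \<in> \<real>"
    using assms amplitude_transverse_real by auto
  then show "E2 / E1 = complex_of_real (cmod E2 / cmod E1) \<or>
      E2 / E1 = - complex_of_real (cmod E2 / cmod E1)"
    by (intro Reals_divide_eq_pm_norm)
  with * show "linearly_polarized E1 E2"
    by (simp add: linearly_polarized_def)
qed

end
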